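(* Let $S=\{i_1<i_2<\cdots<i_s\}$ be a nonempty admissible set, and let $S_1=S\setminus\{i_s\}$ and $S_2=S_1\cup\{i_s-1\}$. Then \[\#\widehat{P}(S,n)=\binom{n}{i_s-1}\,\#\widehat{P}(S_1,i_s-1)\,2^{n-i_s}-\#\widehat{P}(S_1,n)-\#\widehat{P}(S_2,n).\]
   Context: $S_n$ is the set of permutations $\pi=\pi_1\cdots\pi_n$ of $\{1,\dots,n\}$ ($S_0$ consisting of the empty word). Set $\pi_0=0$. An index $i\in\{1,\dots,n-1\}$ is a peak of $\pi$ if $\pi_{i-1}<\pi_i>\pi_{i+1}$. $\widehat{P}(S,n)$ is the set of $\pi\in S_n$ whose peak set (in this sense, with $\pi_0=0$) equals $S$. $S$ is $n$-admissible if $\widehat{P}(S,n)\ne\emptyset$, and admissible if $n$-admissible for some $n$; the identity is asserted for every $n$ for which $S$ is $n$-admissible. *)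

theory Defs
  imports "HOL-Combinatorics.Permutations"
begin

(* A permutation of {1..n} in the sense of permutes fixes every point outside
   {1..n}; in particular p 0 = 0, which is the boundary convention used for
   peaks (so 1 is a peak iff n > 1 and p 1 > p 2). The value p (n + 1) is never
   inspected, since i ranges over {1..<n} only. *)
definition peak_set :: "nat \<Rightarrow> (nat \<Rightarrow> nat) \<Rightarrow> nat set" where
  "peak_set n p = {i \<in> {1..<n}. p (i - 1) < p i \<and> p i > p (i + 1)}"

definition P_hat :: "nat set \<Rightarrow> nat \<Rightarrow> (nat \<Rightarrow> nat) set" where
  "P_hat S n = {p. p permutes {1..n} \<and> peak_set n p = S}"

definition n_admissible :: "nat \<Rightarrow> nat set \<Rightarrow> bool" where
  "n_admissible n S \<longleftrightarrow> P_hat S n \<noteq> {}"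

definition admissible :: "nat set \<Rightarrow> bool" where
  "admissible S \<longleftrightarrow> (\<exists>n. n_admissible n S)"

end

theory Submission
  imports Defs "HOL-Combinatorics.Multiset_Permutations" "HOL-Library.Infinite_Set"
begin

text \<open>
  Let \<open>m\<close> be the largest element of \<open>S\<close>. Count the permutations whose first \<open>m - 1\<close> letters form a word
  with peak set \<open>S - {m}\<close> and whose remaining \<open>n - m + 1\<close> letters form a word that first decreases and
  then increases. The first block depends on its letters only up to order isomorphism, and there are
  \<open>2 ^ (n - m)\<close> choices for the second one, because the maximal letter must stand at one of its ends.
  In such a permutation only \<open>m - 1\<close> and \<open>m\<close> can be further peaks, and not both, which
  yields exactly the peak sets \<open>S\<^sub>1\<close>, \<open>S\<^sub>2\<close> and \<open>S\<close>.
\<close>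

text \<open>Prepending \<open>0\<close> both encodes the convention \<open>p 0 = 0\<close> and makes positions start at \<open>1\<close>.\<close>
definition word_peaks :: "nat list \<Rightarrow> nat set" where
  "word_peaks xs =
     {i \<in> {1..<length xs}. (0 # xs) ! (i - 1) < (0 # xs) ! i \<and> (0 # xs) ! i > (0 # xs) ! (i + 1)}"

text \<open>For distinct letters this is the shape "decreasing, then increasing". No
  \<open>0\<close> is prepended, because the block will follow other letters: whether its first
  letter is a peak depends on the block before it.\<close>

definition valley :: "nat list \<Rightarrow> bool" where
  "valley ys \<longleftrightarrow> (\<forall>i. i + 2 < length ys \<longrightarrow> \<not> (ys ! i < ys ! (i + 1) \<and> ys ! (i + 1) > ys ! (i + 2)))"

section \<open>Permutations as words\<close>

lemma bij_betw_permutes_permutations_of_set: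
  "bij_betw (\<lambda>p. map p [1..<Suc n]) {p. p permutes {1..n}} (permutations_of_set {1..n})"
proof -
  let ?f = "\<lambda>p :: nat \<Rightarrow> nat. map p [1..<Suc n]"
  have inj: "inj_on ?f {p. p permutes {1..n}}"
  proof (rule inj_onI, rule ext)
    fix p q :: "nat \<Rightarrow> nat" and i
    assume pq: "p \<in> {p. p permutes {1..n}}" "q \<in> {p. p permutes {1..n}}" "?f p = ?f q"
    show "p i = q i"
    proof (cases "i \<in> {1..n}")
      case True
      then show ?thesis using pq(3) by (auto simp: map_eq_conv simp del: upt_Suc)
    next
      case False
      then show ?thesis using pq(1,2) by (auto simp: permutes_def)
    qed
  qed
  have "?f p \<in> permutations_of_set {1..n}" if p: "p permutes {1..n}" for p
  proof -
    have "set (?f p) = p ` {1..n}" by (auto simp del: upt_Suc)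
    then have "set (?f p) = {1..n}" using permutes_image[OF p] by simp
    moreover have "distinct (?f p)"
      using inj_on_subset[OF permutes_inj[OF p] subset_UNIV] by (simp add: distinct_map del: upt_Suc)
    ultimately show ?thesis by (simp add: permutations_of_set_def)
  qed
  then have sub: "?f ` {p. p permutes {1..n}} \<subseteq> permutations_of_set {1..n}" by auto
  \<comment> \<open>Surjectivity is obtained by counting: both sides have n! elements.\<close>
  have "card {p. p permutes {1..n}} = fact n"
    by (rule card_permutations) auto
  then have "card (?f ` {p. p permutes {1..n}}) = card (permutations_of_set {1..n})"
    using card_image[OF inj] by simp
  with sub have "?f ` {p. p permutes {1..n}} = permutations_of_set {1..n}"
    by (intro card_subset_eq) auto
  with inj show ?thesis by (simp add: bij_betw_def)
qed

lemma word_peaks_map_permutes: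
  assumes "p permutes {1..n}"
  shows "word_peaks (map p [1..<Suc n]) = peak_set n p"
proof -
  have "p 0 = 0" using assms by (simp add: permutes_def)
  then have "0 # map p [1..<Suc n] = map p [0..<Suc n]"
    by (simp add: upt_conv_Cons del: upt_Suc)
  then have "(0 # map p [1..<Suc n]) ! i = p i" if "i \<le> n" for i
    using that by (simp only: nth_map length_upt nth_upt) simp
  then show ?thesis
    unfolding word_peaks_def peak_set_def by (auto simp del: upt_Suc nth_Cons_Suc)
qed

text \<open>The predicate \<open>Q\<close> is arbitrary because two conditions are transferred
  later: equality with a given set, and a condition on the two sides of a cut.\<close>

lemma card_permutes_peak_set:
  "card {p. p permutes {1..n} \<and> Q (peak_set n p)} =
   card {xs \<in> permutations_of_set {1..n}. Q (word_peaks xs)}"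
proof -
  let ?f = "\<lambda>p :: nat \<Rightarrow> nat. map p [1..<Suc n]"
  note bij = bij_betw_permutes_permutations_of_set[of n]
  have "{xs \<in> permutations_of_set {1..n}. Q (word_peaks xs)} =
      {xs \<in> ?f ` {p. p permutes {1..n}}. Q (word_peaks xs)}"
    using bij_betw_imp_surj_on[OF bij] by (simp only:)
  also have "\<dots> = ?f ` {p. p permutes {1..n} \<and> Q (word_peaks (?f p))}"
    by blast
  also have "\<dots> = ?f ` {p. p permutes {1..n} \<and> Q (peak_set n p)}"
    by (simp only: word_peaks_map_permutes cong: conj_cong)
  finally have "bij_betw ?f {p. p permutes {1..n} \<and> Q (peak_set n p)}
     {xs \<in> permutations_of_set {1..n}. Q (word_peaks xs)}"
    by (intro bij_betw_subset[OF bij]) auto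
  then show ?thesis by (rule bij_betw_same_card)
qed

section \<open>Relabelling the letters\<close>

text \<open>Peaks depend only on comparisons between letters and with the prepended
  \<open>0\<close>, so \<open>f\<close> has to respect the order on \<open>0\<close> as well and to
  fix it.\<close>

lemma word_peaks_map_strict_mono:
  assumes "strict_mono_on (insert 0 (set xs)) f" and "f 0 = 0"
  shows "word_peaks (map f xs) = word_peaks xs"
proof -
  have less: "f ((0 # xs) ! i) < f ((0 # xs) ! j) \<longleftrightarrow> (0 # xs) ! i < (0 # xs) ! j"
    if "i \<le> length xs" "j \<le> length xs" for i j
  proof -
    have "(0 # xs) ! l \<in> insert 0 (set xs)" if "l \<le> length xs" for l
      using that nth_mem[of l "0 # xs"] by simp
    then show ?thesis using that assms(1) by (simp add: strict_mono_on_less)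
  qed
  have "0 # map f xs = map f (0 # xs)" using assms(2) by simp
  then show ?thesis
    unfolding word_peaks_def using less
    by (auto simp del: list.map nth_Cons_Suc nth_Cons_pos simp: less_Suc_eq_le)
qed

lemma card_word_peaks:
  assumes "finite A" and "0 \<notin> A"
  shows "card {xs \<in> permutations_of_set A. word_peaks xs = T} = card (P_hat T (card A))"
proof -
  obtain h where h: "bij_betw h {..<card A} A" "strict_mono_on {..<card A} h"
    using ex_bij_betw_strict_mono_card[OF assms(1)] by blast
  \<comment> \<open>The enumeration \<open>h\<close> of \<open>A\<close> starts at index 0. Shifting
    it by one frees 0 for the boundary letter; monotonicity there uses that all elements of
    \<open>A\<close> are positive.\<close>
  define f where "f i = (if i = 0 then 0 else h (i - 1))" for i
  have "{1..card A} = Suc ` {..<card A}"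
    by (simp add: image_Suc_lessThan)
  then have "f ` {1..card A} = (\<lambda>i. f (Suc i)) ` {..<card A}" by (metis image_image)
  then have img: "f ` {1..card A} = A"
    using h(1) by (simp add: bij_betw_def f_def)
  have mono: "strict_mono_on (insert 0 {1..card A}) f"
  proof (rule strict_mono_onI)
    fix i j assume ij: "i \<in> insert 0 {1..card A}" "j \<in> insert 0 {1..card A}" "i < j"
    then have "f j \<in> A" using img by auto
    with assms(2) have "0 < f j" by (cases "f j") auto
    then show "f i < f j"
      using ij strict_mono_onD[OF h(2), of "i - 1" "j - 1"] by (cases "i = 0") (auto simp: f_def)
  qed
  then have inj: "inj_on f {1..card A}"
    by (meson inj_on_subset strict_mono_on_imp_inj_on subset_insertI)
  have peaks: "word_peaks (map f xs) = word_peaks xs" if "xs \<in> permutations_of_set {1..card A}" for xs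
    using that mono by (intro word_peaks_map_strict_mono) (auto simp: permutations_of_set_def f_def)
  have "permutations_of_set A = map f ` permutations_of_set {1..card A}"
    using permutations_of_set_image_inj[OF inj] img by simp
  then have "{xs \<in> permutations_of_set A. word_peaks xs = T} =
      map f ` {xs \<in> permutations_of_set {1..card A}. word_peaks xs = T}"
    using peaks by auto
  moreover have "inj_on (map f) {xs \<in> permutations_of_set {1..card A}. word_peaks xs = T}"
    using permutations_of_set_lists by (intro inj_on_subset[OF inj_on_map_lists[OF inj]]) blast
  ultimately show ?thesis
    using card_permutes_peak_set[of "card A" "\<lambda>X. X = T"] by (simp add: card_image P_hat_def)
qed

section \<open>Counting words without interior peaks\<close>

text \<open>The only new triple begins with a descent from \<open>x\<close>, so it has no peak in
  its middle.\<close>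

lemma valley_Cons_max:
  assumes "\<And>y. y \<in> set ys \<Longrightarrow> y < x"
  shows "valley (x # ys) \<longleftrightarrow> valley ys"
proof
  assume v: "valley (x # ys)"
  show "valley ys" unfolding valley_def
  proof (intro allI impI)
    fix i assume "i + 2 < length ys"
    then show "\<not> (ys ! i < ys ! (i + 1) \<and> ys ! (i + 1) > ys ! (i + 2))"
      using v[unfolded valley_def, rule_format, of "Suc i"] by simp
  qed
next
  assume v: "valley ys"
  show "valley (x # ys)" unfolding valley_def
  proof (intro allI impI)
    fix i assume i: "i + 2 < length (x # ys)"
    show "\<not> ((x # ys) ! i < (x # ys) ! (i + 1) \<and> (x # ys) ! (i + 1) > (x # ys) ! (i + 2))"
    proof (cases i)
      case 0
      then have "ys ! 0 < x" using i by (intro assms nth_mem) auto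
      with 0 show ?thesis by simp
    next
      case (Suc j)
      then show ?thesis using i v[unfolded valley_def, rule_format, of j] by simp
    qed
  qed
qed

lemma valley_rev: "valley (rev ys) \<longleftrightarrow> valley ys"
proof -
  have "valley (rev ys)" if v: "valley ys" for ys
    unfolding valley_def
  proof (intro allI impI)
    fix i assume i: "i + 2 < length (rev ys)"
    \<comment> \<open>The triple at \<open>i\<close> in the reversed word is the triple at
      \<open>j\<close> in \<open>ys\<close>, read backwards.\<close>
    define j where "j = length ys - (i + 3)"
    have "rev ys ! i = ys ! (j + 2)" "rev ys ! (i + 1) = ys ! (j + 1)" "rev ys ! (i + 2) = ys ! j"
      using i by (auto simp: j_def rev_nth intro!: arg_cong[where f = "nth ys"])
    moreover have "j + 2 < length ys" using i unfolding j_def length_rev by linarith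
    ultimately show "\<not> (rev ys ! i < rev ys ! (i + 1) \<and> rev ys ! (i + 1) > rev ys ! (i + 2))"
      using v[unfolded valley_def, rule_format, of j] by auto
  qed
  from this[of ys] this[of "rev ys"] show ?thesis by auto
qed

lemma valley_snoc_max:
  assumes "\<And>y. y \<in> set ys \<Longrightarrow> y < x"
  shows "valley (ys @ [x]) \<longleftrightarrow> valley ys"
  using valley_Cons_max[of "rev ys" x] assms valley_rev[of "ys @ [x]"] valley_rev[of ys] by simp

lemma not_valley_max_inside:
  assumes "\<And>y. y \<in> set us \<union> set vs \<Longrightarrow> y < x" and "us \<noteq> []" and "vs \<noteq> []"
  shows "\<not> valley (us @ x # vs)"
proof
  assume v: "valley (us @ x # vs)"
  obtain us' u where us: "us = us' @ [u]" using assms(2) by (cases us rule: rev_cases) auto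
  obtain w vs' where vs: "vs = w # vs'" using assms(3) by (cases vs) auto
  have "u < x" "w < x" using assms(1) us vs by auto
  then show False
    using v[unfolded valley_def, rule_format, of "length us'"] us vs by (simp add: nth_append)
qed

text \<open>Induction on the number of letters: the maximum stands at one of the two ends, and
  removing it leaves a word of the same kind. Each letter after the first thus doubles the
  count.\<close>

lemma card_valley:
  assumes "finite B" and "B \<noteq> {}"
  shows "card {ys \<in> permutations_of_set B. valley ys} = 2 ^ (card B - 1)"
  using assms
proof (induction "card B" arbitrary: B)
  case 0
  then show ?case by simp
next
  case (Suc c)
  define M where "M = Max B"
  define B' where "B' = B - {M}"
  have M: "M \<in> B" "\<And>y. y \<in> B' \<Longrightarrow> y < M"
    using Suc.prems unfolding M_def B'_def by (auto simp: order_less_le)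
  have B': "card B' = c" "finite B'" "B = insert M B'" "M \<notin> B'"
    using Suc M unfolding B'_def by auto
  define V where "V = {ys \<in> permutations_of_set B'. valley ys}"
  have V: "ys \<in> V \<longleftrightarrow> set ys = B' \<and> distinct ys \<and> valley ys" for ys
    by (auto simp: V_def permutations_of_set_def)
  have finV: "finite V" by (simp add: V_def)
  have eq: "{ys \<in> permutations_of_set B. valley ys} = Cons M ` V \<union> (\<lambda>ys. ys @ [M]) ` V"
  proof (intro equalityI subsetI)
    fix ys assume "ys \<in> {ys \<in> permutations_of_set B. valley ys}"
    then have ys: "set ys = B" "distinct ys" "valley ys" by (auto simp: permutations_of_set_def)
    then obtain us vs where split: "ys = us @ M # vs" using M(1) split_list by metis
    have sets: "set us \<union> set vs = B'" "M \<notin> set us" "M \<notin> set vs"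
      using ys split by (auto simp: B'_def)
    have "us = [] \<or> vs = []"
      using not_valley_max_inside[of us vs M] ys(3) M(2) sets(1) split by auto
    then show "ys \<in> Cons M ` V \<union> (\<lambda>ys. ys @ [M]) ` V"
    proof
      assume "us = []"
      then show ?thesis
        using split ys sets M(2) valley_Cons_max[of vs M] by (auto simp: V)
    next
      assume "vs = []"
      then show ?thesis
        using split ys sets M(2) valley_snoc_max[of us M] by (auto simp: V)
    qed
  next
    fix ys assume "ys \<in> Cons M ` V \<union> (\<lambda>ys. ys @ [M]) ` V"
    then show "ys \<in> {ys \<in> permutations_of_set B. valley ys}"
      using M(2) B' by (auto simp: V permutations_of_set_def valley_Cons_max valley_snoc_max)
  qed
  show ?case
  proof (cases "c = 0")
    \<comment> \<open>With a single letter the two ends coincide, so the count is 1 and does not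
      double.\<close>
    case True
    then have "B' = {}" using B' by simp
    then have "V = {[]}" by (auto simp: V valley_def)
    then show ?thesis using eq Suc(2) True by simp
  next
    case False
    then have "B' \<noteq> {}" using B' by auto
    then have "card V = 2 ^ (c - 1)" using Suc(1)[of B'] B' by (simp add: V_def)
    \<comment> \<open>A common word would make the nonempty \<open>ys\<close> begin with
      \<open>M\<close>, which is not in \<open>B'\<close>.\<close>
    moreover have "Cons M ` V \<inter> (\<lambda>ys. ys @ [M]) ` V = {}"
    proof -
      have False if "M # xs = ys @ [M]" "xs \<in> V" "ys \<in> V" for xs ys
        using that B'(4) \<open>B' \<noteq> {}\<close> by (cases ys) (auto simp: V)
      then show ?thesis by blast
    qed
    ultimately have "card {ys \<in> permutations_of_set B. valley ys} = 2 ^ (c - 1) + 2 ^ (c - 1)"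
      unfolding eq using finV by (simp add: card_Un_disjoint card_image inj_on_def)
    also have "\<dots> = 2 ^ (card B - 1)"
      using False Suc(2)[symmetric] by (cases c) auto
    finally show ?thesis .
  qed
qed

section \<open>Cutting a word after \<open>k\<close> letters\<close>

text \<open>Position \<open>k\<close> loses its right neighbour in the cut, so exactly the peaks
  strictly below \<open>k\<close> survive.\<close>

lemma word_peaks_take:
  assumes "k \<le> length zs"
  shows "word_peaks (take k zs) = word_peaks zs \<inter> {..<k}"
proof -
  have "0 # take k zs = take (Suc k) (0 # zs)" by simp
  then show ?thesis unfolding word_peaks_def using assms by (auto simp del: take_Suc_Cons)
qed

text \<open>Position \<open>k + 1\<close> becomes the first letter of the remaining block, so the
  first interior position is \<open>k + 2\<close>.\<close>

lemma valley_drop: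
  "valley (drop k zs) \<longleftrightarrow> word_peaks zs \<inter> {k + 1<..} = {}"
proof
  assume v: "valley (drop k zs)"
  have False if i: "i \<in> word_peaks zs" "k + 1 < i" for i
  proof -
    \<comment> \<open>Index in the remaining block of the left neighbour of position
      \<open>i\<close>; list indices start at 0, positions at 1.\<close>
    define j where "j = i - (k + 2)"
    have "i = j + k + 2" using i by (simp add: j_def)
    moreover from this have "j + 2 < length (drop k zs)"
      using i(1) unfolding word_peaks_def length_drop by simp linarith
    ultimately show False
      using v[unfolded valley_def, rule_format, of j] i(1)
      by (auto simp: word_peaks_def ac_simps)
  qed
  then show "word_peaks zs \<inter> {k + 1<..} = {}" by auto
next
  assume e: "word_peaks zs \<inter> {k + 1<..} = {}"
  show "valley (drop k zs)" unfolding valley_def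
  proof (intro allI impI)
    fix i assume "i + 2 < length (drop k zs)"
    moreover have "i + k + 2 \<notin> word_peaks zs" using e by auto
    ultimately show "\<not> (drop k zs ! i < drop k zs ! (i + 1) \<and> drop k zs ! (i + 1) > drop k zs ! (i + 2))"
      by (auto simp: word_peaks_def ac_simps)
  qed
qed

text \<open>Positions \<open>k\<close> and \<open>k + 1\<close>, whose status depends on both
  blocks, are left unconstrained. Hence the blocks are independent once the letter set
  \<open>A\<close> of the first one is chosen, and the three factors count \<open>A\<close>, the
  first block and the second block.\<close>

lemma card_peaks_before_none_after:
  assumes "k < n"
  shows "card {p. p permutes {1..n} \<and> peak_set n p \<inter> {..<k} = T \<and> peak_set n p \<inter> {k + 1<..} = {}} =
    (n choose k) * card (P_hat T k) * 2 ^ (n - k - 1)"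
proof -
  define X where "X = {zs \<in> permutations_of_set {1..n}.
    word_peaks zs \<inter> {..<k} = T \<and> word_peaks zs \<inter> {k + 1<..} = {}}"
  define \<A> where "\<A> = {A. A \<subseteq> {1..n} \<and> card A = k}"
  define U where "U A = {xs \<in> permutations_of_set A. word_peaks xs = T}" for A
  define V where "V B = {ys \<in> permutations_of_set B. valley ys}" for B
  have len: "length zs = n" if "zs \<in> X" for zs
    using that length_finite_permutations_of_set[of zs "{1..n}"] by (auto simp: X_def)
  have "bij_betw (\<lambda>(A, xs, ys). xs @ ys) (SIGMA A:\<A>. U A \<times> V ({1..n} - A)) X"
  proof (rule bij_betw_byWitness[where f' = "\<lambda>zs. (set (take k zs), take k zs, drop k zs)"])
    \<comment> \<open>The fixed length of the first block makes the cut recoverable from the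
      concatenation.\<close>
    have lenU: "length xs = k" if "A \<in> \<A>" "xs \<in> U A" for A xs
      using that by (auto simp: \<A>_def U_def permutations_of_set_def distinct_card)
    show "\<forall>a\<in>SIGMA A:\<A>. U A \<times> V ({1..n} - A).
       (\<lambda>zs. (set (take k zs), take k zs, drop k zs)) ((\<lambda>(A, xs, ys). xs @ ys) a) = a"
      using lenU by (auto simp: U_def permutations_of_set_def)
    show "\<forall>zs\<in>X. (\<lambda>(A, xs, ys). xs @ ys) (set (take k zs), take k zs, drop k zs) = zs" by simp
    show "(\<lambda>(A, xs, ys). xs @ ys) ` (SIGMA A:\<A>. U A \<times> V ({1..n} - A)) \<subseteq> X"
    proof (clarsimp)
      fix A xs ys assume *: "A \<in> \<A>" "xs \<in> U A" "ys \<in> V ({Suc 0..n} - A)"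
      have "length xs = k" using lenU * by simp
      moreover have "xs @ ys \<in> permutations_of_set {1..n}"
        using * by (auto simp: \<A>_def U_def V_def permutations_of_set_def)
      ultimately show "xs @ ys \<in> X"
        using * word_peaks_take[of k "xs @ ys"] valley_drop[of k "xs @ ys"]
        by (auto simp: X_def U_def V_def)
    qed
    show "(\<lambda>zs. (set (take k zs), take k zs, drop k zs)) ` X \<subseteq> (SIGMA A:\<A>. U A \<times> V ({1..n} - A))"
    proof (rule image_subsetI)
      fix zs assume zs: "zs \<in> X"
      then have zs': "set zs = {1..n}" "distinct zs" by (auto simp: X_def permutations_of_set_def)
      have "set (take k zs) \<union> set (drop k zs) = {1..n}"
        using zs' by (metis append_take_drop_id set_append)
      moreover have "set (take k zs) \<inter> set (drop k zs) = {}"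
        using zs' by (simp add: set_take_disj_set_drop_if_distinct)
      ultimately have "set (drop k zs) = {1..n} - set (take k zs)" by blast
      moreover have "card (set (take k zs)) = k"
        using zs' len[OF zs] assms by (simp add: distinct_card)
      ultimately show "(set (take k zs), take k zs, drop k zs) \<in> (SIGMA A:\<A>. U A \<times> V ({1..n} - A))"
        using zs zs' len[OF zs] assms word_peaks_take[of k zs] valley_drop[of k zs]
          set_take_subset[of k zs]
        by (auto simp: X_def \<A>_def U_def V_def permutations_of_set_def)
    qed
  qed
  then have "card X = card (SIGMA A:\<A>. U A \<times> V ({1..n} - A))"
    by (simp add: bij_betw_same_card)
  also have "\<dots> = (\<Sum>A\<in>\<A>. card (U A \<times> V ({1..n} - A)))"
    by (rule card_SigmaI) (auto simp: \<A>_def U_def V_def)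
  also have "\<dots> = (\<Sum>A\<in>\<A>. card (P_hat T k) * 2 ^ (n - k - 1))"
  proof (rule sum.cong[OF refl])
    fix A assume "A \<in> \<A>"
    then have A: "A \<subseteq> {1..n}" "card A = k" by (auto simp: \<A>_def)
    then have "finite A" "0 \<notin> A" by (auto intro: finite_subset)
    then have "card (U A) = card (P_hat T k)" using card_word_peaks[of A T] A by (simp add: U_def)
    moreover have c: "card ({1..n} - A) = n - k"
      using A \<open>finite A\<close> by (simp add: card_Diff_subset)
    \<comment> \<open>Since \<open>k < n\<close>, the second block is nonempty, as
      \<open>card_valley\<close> requires.\<close>
    then have "{1..n} - A \<noteq> {}" using assms by (metis card.empty zero_less_diff less_irrefl)
    then have "card (V ({1..n} - A)) = 2 ^ (n - k - 1)"
      unfolding V_def c[symmetric] by (intro card_valley) auto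
    ultimately show "card (U A \<times> V ({1..n} - A)) = card (P_hat T k) * 2 ^ (n - k - 1)"
      by (simp add: card_cartesian_product)
  qed
  also have "\<dots> = (n choose k) * card (P_hat T k) * 2 ^ (n - k - 1)"
    using n_subsets[of "{1..n}" k] by (simp add: \<A>_def)
  finally show ?thesis
    using card_permutes_peak_set[of n "\<lambda>P. P \<inter> {..<k} = T \<and> P \<inter> {k + 1<..} = {}"]
    by (simp add: X_def)
qed

section \<open>The recursion\<close>

lemma Suc_notin_peak_set: "i \<in> peak_set n p \<Longrightarrow> Suc i \<notin> peak_set n p"
  by (auto simp: peak_set_def)

lemma finite_P_hat: "finite (P_hat S n)"
  by (rule finite_subset[OF _ finite_permutations[of "{1..n}"]]) (auto simp: P_hat_def)

theorem theorem4p1: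
  fixes S :: "nat set" and n :: nat
  assumes "S \<noteq> {}" and "admissible S" and "n_admissible n S"
  shows "let m = Max S; S\<^sub>1 = S - {m}; S\<^sub>2 = S\<^sub>1 \<union> {m - 1} in
    int (card (P_hat S n)) =
      int (n choose (m - 1)) * int (card (P_hat S\<^sub>1 (m - 1))) * 2 ^ (n - m)
      - int (card (P_hat S\<^sub>1 n)) - int (card (P_hat S\<^sub>2 n))"
proof -
  \<comment> \<open>Realising \<open>S\<close> as a peak set confines it to \<open>{1..<n}\<close>
    and rules out consecutive elements.\<close>
  obtain q where q: "S = peak_set n q"
    using assms(3) by (auto simp: n_admissible_def P_hat_def)
  define k where "k = Max S - 1"
  define S1 where "S1 = S - {Max S}"
  \<comment> \<open>If \<open>k = 0\<close>, then \<open>S2\<close> contains 0, which is never a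
    peak; \<open>P_hat S2 n\<close> is then empty and the count still holds.\<close>
  define S2 where "S2 = S1 \<union> {k}"
  have S: "S \<subseteq> {1..<n}" "finite S" using q by (auto simp: peak_set_def)
  then have mS: "Max S \<in> S" using assms(1) by simp
  then have "Max S \<in> {1..<n}" using S(1) by blast
  then have m: "Max S = Suc k" "k < n" by (auto simp: k_def)
  \<comment> \<open>This places all of \<open>S1\<close> strictly below \<open>k\<close>, where the
    first block determines the peaks.\<close>
  have "k \<notin> S" using Suc_notin_peak_set[of k n q] mS m q by auto
  have S1: "S1 \<subseteq> {..<k}"
  proof
    fix i assume i: "i \<in> S1"
    then have "i \<le> Suc k" using Max_ge[OF S(2), of i] m by (auto simp: S1_def)
    with i \<open>k \<notin> S\<close> m show "i \<in> {..<k}"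
      by (cases "i = k"; cases "i = Suc k") (auto simp: S1_def)
  qed
  have S_eq: "S = insert (Suc k) S1" using mS m by (auto simp: S1_def)
  let ?X = "{p. p permutes {1..n} \<and> peak_set n p \<inter> {..<k} = S1 \<and> peak_set n p \<inter> {k + 1<..} = {}}"
  \<comment> \<open>Only \<open>k\<close> and \<open>Suc k\<close> remain undecided, and not both
    are peaks: neither gives \<open>S1\<close>, \<open>k\<close> alone gives \<open>S2\<close>, and
    \<open>Suc k\<close> alone gives \<open>S\<close>.\<close>
  have cases: "P \<inter> {..<k} = S1 \<and> P \<inter> {k + 1<..} = {} \<longleftrightarrow> P = S1 \<or> P = S2 \<or> P = S"
    if "k \<in> P \<Longrightarrow> Suc k \<notin> P" for P
  proof
    assume P: "P \<inter> {..<k} = S1 \<and> P \<inter> {k + 1<..} = {}"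
    have "i < k \<or> i = k \<or> i = Suc k" if "i \<in> P" for i using P that by fastforce
    then have "P = S1 \<union> (P \<inter> {k, Suc k})" using P by blast
    then show "P = S1 \<or> P = S2 \<or> P = S"
      using that unfolding S_eq S2_def by (cases "k \<in> P"; cases "Suc k \<in> P") auto
  next
    assume "P = S1 \<or> P = S2 \<or> P = S"
    then show "P \<inter> {..<k} = S1 \<and> P \<inter> {k + 1<..} = {}"
      using S1 unfolding S_eq S2_def by fastforce
  qed
  have X: "?X = P_hat S1 n \<union> P_hat S2 n \<union> P_hat S n"
    using cases[OF Suc_notin_peak_set] by (auto simp: P_hat_def)
  have "S1 \<noteq> S2" "S1 \<noteq> S" "S2 \<noteq> S" using S1 unfolding S_eq S2_def by auto
  then have "P_hat S1 n \<inter> P_hat S2 n = {}" "(P_hat S1 n \<union> P_hat S2 n) \<inter> P_hat S n = {}"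
    unfolding P_hat_def by blast+
  then have "card ?X = card (P_hat S1 n) + card (P_hat S2 n) + card (P_hat S n)"
    unfolding X by (simp add: card_Un_disjoint finite_P_hat)
  then have "card (P_hat S1 n) + card (P_hat S2 n) + card (P_hat S n) =
      (n choose k) * card (P_hat S1 k) * 2 ^ (n - Suc k)"
    using card_peaks_before_none_after[OF m(2), of S1] by simp
  \<comment> \<open>The additive identity is moved to the integers before solving for the count of
    \<open>S\<close>, so that no subtraction is truncated.\<close>
  then have "int (card (P_hat S1 n)) + int (card (P_hat S2 n)) + int (card (P_hat S n)) =
      int (n choose k) * int (card (P_hat S1 k)) * 2 ^ (n - Suc k)"
    by (metis of_nat_add of_nat_mult of_nat_power of_nat_numeral)
  moreover have "Max S - 1 = k" "S - {Suc k} = S1" using m by (auto simp: S1_def)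
  ultimately show ?thesis
    using m by (simp add: Let_def S2_def)
qed

end
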